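(* Let $0<\alpha,\beta<1$ and let $f\in\mathcal{S}(\mathbb{R})$ be a (complex-valued) Schwartz function. Then: (A) If $f(\pm\log(n+1))=0$ and $\widehat{f}(\pm n^{\alpha})=0$ for every $n\in\mathbb{N}$, then $f\equiv 0$. (B) Suppose $(\alpha,\beta)\in A$, where $$A=\left\{(\alpha,\beta)\in[0,1]^2 : \alpha+\beta<1 \text{ and either } \alpha<1-\frac{\beta}{1-\alpha-\beta} \text{ or } \beta<1-\frac{\alpha}{1-\alpha-\beta}\right\}.$$ If $f(\pm n^{\alpha})=0$ and $\widehat{f}(\pm n^{\beta})=0$ for every $n\in\mathbb{N}$, then $f\equiv 0$.
   Context: The Fourier transform of an integrable function $f:\mathbb{R}\to\mathbb{C}$ is normalised as $\widehat{f}(\xi)=\int_{\mathbb{R}} f(x)e^{2\pi i x\xi}\,\mathrm{d}x$. $\mathcal{S}(\mathbb{R})$ denotes the Schwartz class of functions $\mathbb{R}\to\mathbb{C}$. $\mathbb{N}=\{0,1,2,\dots\}$. In the definition of $A$, "either ... or" means that at least one of the two inequalities holds. *)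

theory Defs
  imports "HOL-Analysis.Analysis"
begin

definition nth_deriv :: "nat \<Rightarrow> (real \<Rightarrow> complex) \<Rightarrow> real \<Rightarrow> complex" where
  "nth_deriv k f = ((\<lambda>g x. vector_derivative g (at x)) ^^ k) f"

text \<open>
  The library's \<^const>\<open>vector_derivative\<close> is total, so smoothness has to be required
  explicitly: the first conjunct says that every iterated derivative is genuine.
\<close>

definition schwartz :: "(real \<Rightarrow> complex) \<Rightarrow> bool" where
  "schwartz f \<longleftrightarrow>
     (\<forall>k x. nth_deriv k f differentiable (at x)) \<and>
     (\<forall>j k. \<exists>C. \<forall>x. \<bar>x\<bar> ^ j * cmod (nth_deriv k f x) \<le> C)"

text \<open>Sign convention: the kernel is \<open>e\<^bsup>+2\<pi>ix\<xi>\<^esup>\<close>.\<close>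

definition fourier :: "(real \<Rightarrow> complex) \<Rightarrow> real \<Rightarrow> complex" where
  "fourier f \<xi> = (\<integral>x. f x * exp (2 * complex_of_real pi * \<i> * complex_of_real (x * \<xi>)) \<partial>lborel)"

definition exponent_region :: "(real \<times> real) set" where
  "exponent_region = {(\<alpha>, \<beta>). \<alpha> \<in> {0..1} \<and> \<beta> \<in> {0..1} \<and> \<alpha> + \<beta> < 1 \<and>
          (\<alpha> < 1 - \<beta> / (1 - \<alpha> - \<beta>) \<or> \<beta> < 1 - \<alpha> / (1 - \<alpha> - \<beta>))}"

end

theory Submission
  imports Defs "HOL-Probability.Probability" "HOL-Computational_Algebra.Polynomial"
begin

text \<open>
  If \<open>f\<close> vanishes on a set whose gaps near \<open>x\<close> have size \<open>O(\<bar>x\<bar>\<^sup>1\<^sup>-\<^sup>p)\<close>, then there are \<open>n\<close> zeros at distance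
  \<open>O(n \<bar>x\<bar>\<^sup>1\<^sup>-\<^sup>p)\<close> from \<open>x\<close>. Lagrange interpolation of \<open>t \<mapsto> e\<^sup>i\<^sup>w\<^sup>t\<close> at these zeros, integrated against
  the Fourier transform \<open>g\<close> of \<open>f\<close>, gives
  \<open>\<bar>x\<bar>\<^bsup>(p-1)n\<^esup> \<bar>f(x)\<bar> \<le> K\<^sup>n \<integral> \<bar>\<xi>\<bar>\<^sup>n \<bar>g(\<xi>)\<bar> d\<xi>\<close>, where the factor \<open>n\<^sup>n\<close> is absorbed by
  the \<open>n!\<close> of the remainder term. The same holds with the two functions exchanged and an exponent \<open>q\<close>.
  When \<open>(p-1)(q-1) > 1\<close>, alternating the two estimates bounds arbitrarily high moments of \<open>f\<close> by
  \<open>A\<^sup>m\<close>, so \<open>f\<close> has compact support. Then its transform vanishes far out, and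
  interpolating it there at arbitrarily many points of a fixed interval shows that it is zero.
  For zeros at \<open>\<plusminus>n\<^sup>\<alpha>\<close> one has \<open>p = 1/\<alpha>\<close>, and the condition on \<open>p, q\<close> becomes
  \<open>\<alpha> + \<beta> < 1\<close>; for the logarithms, \<open>p\<close> is arbitrary.
\<close>

subsection \<open>Lagrange interpolation of the exponential\<close>

text \<open>Induction on the largest point. The conjunct \<open>\<exists>s\<in>S. t < s\<close>
  carries the induction: it keeps the zeros already found below \<open>Max A\<close>, so the Rolle
  point between \<open>Max A\<close> and the new maximum \<open>b\<close> is a new one.\<close>

lemma Rolle_finite_set:
  fixes g g' :: "real \<Rightarrow> real"
  assumes "finite S" and "\<And>t. (g has_real_derivative g' t) (at t)"
    and "\<And>s. s \<in> S \<Longrightarrow> g s = 0" and "S \<noteq> {}"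
  shows "\<exists>T. finite T \<and> Suc (card T) = card S \<and> (\<forall>t\<in>T. g' t = 0) \<and> (\<forall>t\<in>T. \<exists>s\<in>S. t < s)"
  using assms(1,3,4)
proof (induction S rule: finite_linorder_max_induct)
  case empty
  then show ?case by simp
next
  case (insert b A)
  have b: "b \<notin> A" using insert.hyps by blast
  show ?case
  proof (cases "A = {}")
    case True
    then show ?thesis by (intro exI[of _ "{}"]) auto
  next
    case False
    obtain T where T: "finite T" "Suc (card T) = card A" "\<forall>t\<in>T. g' t = 0" "\<forall>t\<in>T. \<exists>s\<in>A. t < s"
      using insert False by auto
    define m where "m = Max A"
    have m: "m \<in> A" "\<And>a. a \<in> A \<Longrightarrow> a \<le> m"
      using insert.hyps False by (auto simp: m_def)
    have "m < b" using insert.hyps m by auto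
    have "\<exists>z>m. z < b \<and> (\<lambda>v. v * g' z) = (\<lambda>v. 0)"
    proof (rule Rolle_deriv[OF \<open>m < b\<close>, of g])
      show "g m = g b" using insert.prems m by auto
      show "continuous_on {m..b} g"
        by (intro DERIV_continuous_on) (use assms(2) has_field_derivative_at_within in blast)
      show "(g has_derivative (\<lambda>v. v * g' x)) (at x)" for x
        using assms(2)[of x] by (simp add: has_field_derivative_def mult_commute_abs)
    qed
    then obtain z where z: "m < z" "z < b" "g' z = 0"
      by (metis mult_1)
    have "z \<notin> T" using T(4) m(2) z(1) by force
    then show ?thesis
      using T z insert.hyps b m(1)
      by (intro exI[of _ "insert z T"]) auto
  qed
qed

text \<open>The family \<open>H\<close> encodes a function with its successive derivatives. Each use
  of Rolle's theorem costs one zero, so \<open>Suc n\<close> zeros leave one after \<open>n\<close>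
  differentiations.\<close>

lemma Rolle_higher_deriv:
  fixes H :: "nat \<Rightarrow> real \<Rightarrow> real"
  assumes "\<And>k t. (H k has_real_derivative H (Suc k) t) (at t)"
    and "finite S" and "card S = Suc n" and "\<And>s. s \<in> S \<Longrightarrow> H 0 s = 0"
  shows "\<exists>\<eta>. H n \<eta> = 0"
  using assms
proof (induction n arbitrary: H S)
  case 0
  then show ?case by (metis One_nat_def card_1_singletonE insertI1)
next
  case (Suc n)
  obtain T where "finite T" "Suc (card T) = card S" "\<forall>t\<in>T. H (Suc 0) t = 0"
    using Rolle_finite_set[of S "H 0" "H (Suc 0)"] Suc.prems by fastforce
  with Suc.IH[of "\<lambda>k. H (Suc k)" T] Suc.prems show ?case by auto
qed

section \<open>Lagrange polynomials and the interpolation remainder\<close>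

lemma poly_higher_pderiv_degree_le:
  fixes P :: "real poly"
  assumes "degree P \<le> n"
  shows "poly ((pderiv ^^ n) P) x = fact n * coeff P n"
proof -
  have "degree ((pderiv ^^ n) P) = 0"
    using assms by (simp add: degree_higher_pderiv)
  then have "poly ((pderiv ^^ n) P) x = coeff ((pderiv ^^ n) P) 0"
    by (auto elim!: degree_eq_zeroE)
  then show ?thesis by (simp add: coeff_higher_pderiv pochhammer_fact)
qed

definition lagrange_basis :: "real set \<Rightarrow> real \<Rightarrow> real poly" where
  "lagrange_basis Z z = (\<Prod>y\<in>Z - {z}. smult (1 / (z - y)) [:- y, 1:])"

lemma poly_lagrange_basis:
  assumes "finite Z" "z \<in> Z" "w \<in> Z"
  shows "poly (lagrange_basis Z z) w = (if w = z then 1 else 0)"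
proof (cases "w = z")
  case True
  have "poly (lagrange_basis Z z) z = (\<Prod>y\<in>Z - {z}. 1)"
    unfolding lagrange_basis_def poly_prod
    by (intro prod.cong) (auto simp flip: diff_divide_distrib)
  then show ?thesis using True by simp
next
  case False
  then show ?thesis using assms by (auto simp: lagrange_basis_def poly_prod intro!: prod_zero)
qed

lemma degree_lagrange_basis:
  assumes "finite Z" "z \<in> Z"
  shows "degree (lagrange_basis Z z) < card Z"
proof -
  have "degree (lagrange_basis Z z) \<le> (\<Sum>y\<in>Z - {z}. 1)"
    unfolding lagrange_basis_def using assms
    by (intro order.trans[OF degree_prod_sum_le] sum_mono) auto
  also have "\<dots> < card Z"
    using assms card_gt_0_iff[of Z] by auto
  finally show ?thesis .
qed

text \<open>The interpolation polynomial \<open>Q\<close> is corrected by a multiple of the node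
  polynomial \<open>W\<close> to agree with \<open>H 0\<close> at \<open>x\<close> as well. The
  difference then has one zero more than there are nodes, so its derivative of order
  \<open>card Z\<close> vanishes somewhere, which determines the multiple.\<close>

lemma lagrange_remainder:
  fixes H :: "nat \<Rightarrow> real \<Rightarrow> real"
  assumes deriv: "\<And>k t. (H k has_real_derivative H (Suc k) t) (at t)"
    and Z: "finite Z" and x: "x \<notin> Z"
  shows "\<exists>\<eta>. H 0 x - (\<Sum>z\<in>Z. poly (lagrange_basis Z z) x * H 0 z)
              = H (card Z) \<eta> * (\<Prod>z\<in>Z. x - z) / fact (card Z)"
proof -
  define n where "n = card Z"
  define W :: "real poly" where "W = (\<Prod>z\<in>Z. [:- z, 1:])"
  define Q where "Q = (\<Sum>z\<in>Z. smult (H 0 z) (lagrange_basis Z z))"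
  \<comment> \<open>This value makes \<open>P\<close> agree with \<open>H 0\<close> at
    \<open>x\<close>; at the nodes \<open>W\<close> vanishes and the agreement of \<open>Q\<close>
    persists.\<close>
  define A where "A = (H 0 x - poly Q x) / poly W x"
  define P where "P = Q + smult A W"
  have W: "degree W = n" "coeff W n = 1"
  proof -
    show "degree W = n"
      unfolding W_def n_def by (subst degree_prod_eq_sum_degree) auto
    then show "coeff W n = 1"
      using lead_coeff_prod[of "\<lambda>z. [:- z, 1:]" Z] by (simp add: W_def)
  qed
  have Wx: "poly W x = (\<Prod>z\<in>Z. x - z)" "poly W x \<noteq> 0"
    using Z x by (auto simp: W_def poly_prod)
  have Q: "coeff Q n = 0"
    unfolding Q_def coeff_sum
    using degree_lagrange_basis[OF Z] by (intro sum.neutral) (auto simp: n_def coeff_eq_0)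
  have "degree Q \<le> n"
    unfolding Q_def using degree_lagrange_basis[OF Z]
    by (intro degree_sum_le) (auto simp: n_def Z intro!: order.trans[OF degree_smult_le] less_imp_le)
  then have "degree P \<le> n"
    unfolding P_def using W by (intro degree_add_le order.trans[OF degree_smult_le]) auto
  then have Pn: "poly ((pderiv ^^ n) P) t = fact n * A" for t
    by (simp add: poly_higher_pderiv_degree_le P_def Q W)
  have Q_node: "poly Q z = H 0 z" if "z \<in> Z" for z
  proof -
    have "poly Q z = (\<Sum>w\<in>Z. H 0 w * (if z = w then 1 else 0))"
      unfolding Q_def poly_sum using that Z
      by (intro sum.cong) (auto simp: poly_lagrange_basis)
    also have "\<dots> = (\<Sum>w\<in>Z. if z = w then H 0 w else 0)"
      by (intro sum.cong) auto
    finally show ?thesis using that Z by simp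
  qed
  have "\<exists>\<eta>. H n \<eta> - poly ((pderiv ^^ n) P) \<eta> = 0"
  proof (rule Rolle_higher_deriv[where S = "insert x Z"])
    fix k t
    show "((\<lambda>t. H k t - poly ((pderiv ^^ k) P) t) has_real_derivative
        (H (Suc k) t - poly ((pderiv ^^ Suc k) P) t)) (at t)"
      using deriv[of k t] by (auto intro!: derivative_eq_intros)
  next
    show "finite (insert x Z)" "card (insert x Z) = Suc n"
      using Z x by (auto simp: n_def)
  next
    fix s assume "s \<in> insert x Z"
    moreover have "poly W z = 0" if "z \<in> Z" for z
      using that Z by (auto simp: W_def poly_prod intro!: prod_zero)
    ultimately show "H 0 s - poly ((pderiv ^^ 0) P) s = 0"
      using Wx(2) Q_node by (auto simp: P_def A_def)
  qed
  then obtain \<eta> where \<eta>: "H n \<eta> = fact n * A" using Pn by auto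
  have "poly Q x = (\<Sum>z\<in>Z. poly (lagrange_basis Z z) x * H 0 z)"
    by (simp add: Q_def poly_sum mult.commute)
  then have "H 0 x - (\<Sum>z\<in>Z. poly (lagrange_basis Z z) x * H 0 z) = A * poly W x"
    using Wx(2) by (simp add: A_def)
  also have "\<dots> = H n \<eta> * (\<Prod>z\<in>Z. x - z) / fact n"
    using \<eta> Wx(1) by simp
  finally show ?thesis unfolding n_def by blast
qed

text \<open>Rotating the error by a suitable phase makes it real, which reduces the claim to a shifted cosine.\<close>

lemma lagrange_error_cis:
  assumes Z: "finite Z" and x: "x \<notin> Z"
  shows "cmod (cis (w * x) - (\<Sum>z\<in>Z. of_real (poly (lagrange_basis Z z) x) * cis (w * z)))
           \<le> \<bar>w\<bar> ^ card Z * (\<Prod>z\<in>Z. \<bar>x - z\<bar>) / fact (card Z)"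
    (is "cmod ?e \<le> _")
proof -
  define \<theta> where "\<theta> = Arg ?e"
  \<comment> \<open>\<open>H k\<close> is the \<open>k\<close>-th derivative of the cosine with
    phase \<open>\<theta>\<close>: each differentiation contributes a factor \<open>w\<close> and a
    shift by \<open>pi / 2\<close>. Hence it is bounded by \<open>\<bar>w\<bar> ^ k\<close>.\<close>
  define H where "H = (\<lambda>k t. w ^ k * cos (w * t - \<theta> + of_nat k * (pi / 2)))"
  have "(H k has_real_derivative H (Suc k) t) (at t)" for k t
  proof -
    have "cos (w * t - \<theta> + of_nat (Suc k) * (pi / 2)) = - sin (w * t - \<theta> + of_nat k * (pi / 2))"
    proof -
      have "w * t - \<theta> + of_nat (Suc k) * (pi / 2) = (w * t - \<theta> + of_nat k * (pi / 2)) + pi / 2"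
        by (simp add: field_simps)
      moreover have "cos (u + pi / 2) = - sin u" for u :: real by (simp add: cos_add)
      ultimately show ?thesis by (simp only:)
    qed
    then show ?thesis
      unfolding H_def by (auto intro!: derivative_eq_intros)
  qed
  from lagrange_remainder[of H, OF this Z x] obtain \<eta> where
    \<eta>: "H 0 x - (\<Sum>z\<in>Z. poly (lagrange_basis Z z) x * H 0 z)
          = H (card Z) \<eta> * (\<Prod>z\<in>Z. x - z) / fact (card Z)"
    by blast
  have "cis (- \<theta>) * ?e = cis (- \<theta>) * (of_real (cmod ?e) * cis \<theta>)"
    by (rule arg_cong[where f = "(*) (cis (- \<theta>))"]) (metis \<theta>_def rcis_cmod_Arg rcis_def)
  also have "\<dots> = of_real (cmod ?e) * (cis (- \<theta>) * cis \<theta>)" by (rule mult.left_commute)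
  also have "\<dots> = of_real (cmod ?e)" by (simp only: cis_mult) simp
  finally have "of_real (cmod ?e) = cis (- \<theta>) * ?e" by (rule sym)
  also have "\<dots> = cis (w * x - \<theta>) - (\<Sum>z\<in>Z. of_real (poly (lagrange_basis Z z) x) * cis (w * z - \<theta>))"
    by (simp add: right_diff_distrib sum_distrib_left mult.left_commute[of "cis (- \<theta>)"] cis_mult)
  \<comment> \<open>The Lagrange coefficients are real, so taking real parts turns the rotated error
    into the interpolation error of \<open>H 0\<close>.\<close>
  finally have "cmod ?e = Re \<dots>"
    by (metis Re_complex_of_real)
  also have "\<dots> = H 0 x - (\<Sum>z\<in>Z. poly (lagrange_basis Z z) x * H 0 z)"
    by (simp add: H_def)
  also have "\<dots> \<le> \<bar>H (card Z) \<eta>\<bar> * (\<Prod>z\<in>Z. \<bar>x - z\<bar>) / fact (card Z)"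
    unfolding \<eta> by (rule order.trans[OF abs_ge_self]) (simp add: abs_mult abs_prod)
  also have "\<dots> \<le> \<bar>w\<bar> ^ card Z * (\<Prod>z\<in>Z. \<bar>x - z\<bar>) / fact (card Z)"
    by (intro divide_right_mono mult_right_mono prod_nonneg)
       (auto simp: H_def abs_mult power_abs intro!: mult_left_le)
  finally show ?thesis .
qed

subsection \<open>Decay of a Fourier transform with dense zeros\<close>

lemma fourier_altdef: "fourier g \<xi> = (\<integral>x. g x * cis (2 * pi * x * \<xi>) \<partial>lborel)"
  unfolding fourier_def by (simp add: cis_conv_exp algebra_simps)

lemma integrable_mult_cis:
  assumes "integrable lborel g"
  shows "integrable lborel (\<lambda>x. g x * cis (2 * pi * x * \<xi>))"
  by (rule Bochner_Integration.integrable_bound[OF assms])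
     (use assms in \<open>auto simp: norm_mult cis_conv_exp\<close>)

text \<open>Since the transform vanishes on \<open>Z\<close>, any combination of its values there
  can be subtracted at no cost. With the Lagrange coefficients at \<open>\<xi>\<close>, the kernel
  is replaced by its interpolation error \<open>E\<close>, estimated by
  \<open>lagrange_error_cis\<close> with \<open>w = 2 * pi * x\<close>.\<close>

lemma fourier_le_moment:
  assumes g: "integrable lborel g" and mom: "integrable lborel (\<lambda>x. \<bar>x\<bar> ^ n * cmod (g x))"
    and Z: "finite Z" "card Z = n" "\<And>z. z \<in> Z \<Longrightarrow> fourier g z = 0"
  shows "cmod (fourier g \<xi>)
           \<le> (2 * pi) ^ n * (\<Prod>z\<in>Z. \<bar>\<xi> - z\<bar>) / fact n * (\<integral>x. \<bar>x\<bar> ^ n * cmod (g x) \<partial>lborel)"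
proof (cases "\<xi> \<in> Z")
  case True
  then show ?thesis using Z by (auto intro!: mult_nonneg_nonneg divide_nonneg_nonneg prod_nonneg integral_nonneg_AE)
next
  case False
  define E where "E = (\<lambda>x. cis (2 * pi * x * \<xi>) -
      (\<Sum>z\<in>Z. of_real (poly (lagrange_basis Z z) \<xi>) * cis (2 * pi * x * z)))"
  note int = integrable_mult_cis[OF g]
  have eq: "(\<lambda>x. g x * E x) = (\<lambda>x. g x * cis (2 * pi * x * \<xi>) -
      (\<Sum>z\<in>Z. of_real (poly (lagrange_basis Z z) \<xi>) * (g x * cis (2 * pi * x * z))))"
    by (simp add: E_def right_diff_distrib sum_distrib_left mult.left_commute)
  have "fourier g \<xi> = (\<integral>x. g x * E x \<partial>lborel)"
    unfolding eq using int Z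
    by (subst Bochner_Integration.integral_diff)
       (auto simp: Bochner_Integration.integral_sum simp flip: fourier_altdef)
  moreover have gE: "integrable lborel (\<lambda>x. g x * E x)"
    unfolding eq using int by auto
  ultimately have "cmod (fourier g \<xi>) \<le> (\<integral>x. cmod (g x * E x) \<partial>lborel)"
    by simp
  also have "\<dots> \<le> (\<integral>x. (2 * pi) ^ n * (\<Prod>z\<in>Z. \<bar>\<xi> - z\<bar>) / fact n * (\<bar>x\<bar> ^ n * cmod (g x)) \<partial>lborel)"
  proof (rule integral_mono)
    show "integrable lborel (\<lambda>x. cmod (g x * E x))" using gE by simp
    show "integrable lborel (\<lambda>x. (2 * pi) ^ n * (\<Prod>z\<in>Z. \<bar>\<xi> - z\<bar>) / fact n * (\<bar>x\<bar> ^ n * cmod (g x)))"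
      using mom by simp
    fix x
    have "cmod (E x) \<le> \<bar>2 * pi * x\<bar> ^ n * (\<Prod>z\<in>Z. \<bar>\<xi> - z\<bar>) / fact n"
      using lagrange_error_cis[OF Z(1) False, of "2 * pi * x"] by (simp add: E_def Z(2))
    then have "cmod (g x) * cmod (E x)
        \<le> cmod (g x) * (\<bar>2 * pi * x\<bar> ^ n * (\<Prod>z\<in>Z. \<bar>\<xi> - z\<bar>) / fact n)"
      by (rule mult_left_mono) simp
    then show "cmod (g x * E x) \<le> (2 * pi) ^ n * (\<Prod>z\<in>Z. \<bar>\<xi> - z\<bar>) / fact n * (\<bar>x\<bar> ^ n * cmod (g x))"
      by (simp add: norm_mult abs_mult power_mult_distrib mult_ac)
  qed
  finally show ?thesis by simp
qed

text \<open>The order \<open>m\<close> is real because orders such as \<open>(p - 1) * n\<close>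
  occur. The weight is at least 1, so it increases with \<open>m\<close> and also controls
  \<open>g\<close> near the origin. The bound \<open>D\<close> is explicit because its growth under
  iteration has to be tracked.\<close>

definition decays :: "(real \<Rightarrow> complex) \<Rightarrow> real \<Rightarrow> real \<Rightarrow> bool" where
  "decays g m D \<longleftrightarrow> (\<forall>x. max 1 \<bar>x\<bar> powr m * cmod (g x) \<le> D)"

text \<open>The exponent is normalised so that zeros at \<plusminus>n^(1/p) qualify: their spacing
  near \<open>x\<close> is of size |x|^(1-p).\<close>

definition zero_gaps :: "(real \<Rightarrow> complex) \<Rightarrow> real \<Rightarrow> real \<Rightarrow> bool" where
  "zero_gaps G p C \<longleftrightarrow> (\<forall>x. \<bar>x\<bar> \<ge> 1 \<longrightarrow> (\<exists>z. G z = 0 \<and> \<bar>z - x\<bar> \<le> C * \<bar>x\<bar> powr (1 - p)))"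

lemma decays_nonneg: "decays g m D \<Longrightarrow> 0 \<le> D"
  unfolding decays_def by (metis dual_order.trans mult_nonneg_nonneg norm_ge_zero powr_ge_zero)

lemma decays_mono: "decays g m D \<Longrightarrow> m' \<le> m \<Longrightarrow> decays g m' D"
  unfolding decays_def
  by (meson dual_order.trans max.cobounded1 mult_right_mono norm_ge_zero powr_mono)

lemma zero_gaps_finite_set:
  assumes gaps: "zero_gaps G p C" and p: "p > 1" and C: "C > 0" and x: "\<bar>x\<bar> \<ge> 1"
  shows "\<exists>Z. finite Z \<and> card Z = n \<and>
           (\<forall>z\<in>Z. G z = 0 \<and> \<bar>x - z\<bar> \<le> 3 * real n * (C * \<bar>x\<bar> powr (1 - p)))"
proof -
  define \<delta> where "\<delta> = C * \<bar>x\<bar> powr (1 - p)"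
  have \<delta>: "\<delta> > 0" using C x by (auto simp: \<delta>_def)
  \<comment> \<open>The centres move away from the origin, where for \<open>p > 1\<close> the gap
    bound only shrinks and so stays below \<open>\<delta>\<close>. Their spacing
    \<open>3 * \<delta>\<close> exceeds twice the radius, so zeros near different centres are
    distinct.\<close>
  define y where "y = (\<lambda>k::nat. x + sgn x * (3 * real k * \<delta>))"
  have abs_y: "\<bar>y k\<bar> = \<bar>x\<bar> + 3 * real k * \<delta>" for k
  proof -
    have "\<bar>x + sgn x * a\<bar> = \<bar>x\<bar> + a" if "a \<ge> 0" for a
      using x that by (auto simp: sgn_if abs_if)
    then show ?thesis unfolding y_def using \<delta> by simp
  qed
  have "\<exists>z. G z = 0 \<and> \<bar>z - y k\<bar> \<le> \<delta>" for k
  proof -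
    have ge: "\<bar>y k\<bar> \<ge> \<bar>x\<bar>" using abs_y[of k] \<delta> by simp
    then obtain z where z: "G z = 0" "\<bar>z - y k\<bar> \<le> C * \<bar>y k\<bar> powr (1 - p)"
      using gaps x unfolding zero_gaps_def by (meson order.trans)
    have "C * \<bar>y k\<bar> powr (1 - p) \<le> \<delta>"
      unfolding \<delta>_def using C p x ge by (intro mult_left_mono powr_mono2') auto
    then show ?thesis using z by force
  qed
  then obtain z where z: "\<And>k. G (z k) = 0" "\<And>k. \<bar>z k - y k\<bar> \<le> \<delta>" by metis
  have inj: "inj z"
  proof (rule linorder_injI)
    fix j k :: nat assume "j < k"
    then have "1 * \<delta> \<le> (real k - real j) * \<delta>" using \<delta> by (intro mult_right_mono) auto
    then have "real j * \<delta> + \<delta> \<le> real k * \<delta>" by (simp add: algebra_simps)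
    then have "\<bar>y k - y j\<bar> \<ge> 3 * \<delta>"
      using x by (cases "x > 0") (auto simp: y_def sgn_if)
    then show "z j \<noteq> z k" using z(2)[of j] z(2)[of k] \<delta> by auto
  qed
  have "\<bar>x - z k\<bar> \<le> 3 * real n * \<delta>" if "k < n" for k
  proof -
    have "real (Suc k) * \<delta> \<le> real n * \<delta>" using that \<delta> by (intro mult_right_mono) auto
    moreover have "\<bar>x - y k\<bar> = 3 * real k * \<delta>" using \<delta> x by (auto simp: y_def abs_mult abs_sgn_eq)
    ultimately show ?thesis using z(2)[of k] \<delta> by (simp add: algebra_simps)
  qed
  then show ?thesis
    using z(1) inj unfolding \<delta>_def
    by (intro exI[of _ "z ` {..<n}"]) (auto simp: card_image inj_on_def inj_def)
qed

text \<open>One term of the exponential series is at most the sum. For x = n this gives n^n \<le> n!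
  e^n, which tames the distances to \<open>n\<close> zeros; it also shows that exp(-x) is beaten by
  every negative power.\<close>

lemma power_le_fact_exp:
  fixes x :: real
  assumes "x \<ge> 0"
  shows "x ^ n \<le> fact n * exp x"
proof -
  have "(\<Sum>k\<in>{n}. x ^ k /\<^sub>R fact k) \<le> exp x"
    using exp_converges[of x] assms
    by (subst sums_unique[OF exp_converges]) (intro sum_le_suminf, auto simp: sums_iff)
  then show ?thesis by (simp add: field_simps)
qed

text \<open>The \<open>n\<close> zeros nearby make the product of distances at most (3 n C r)^n,
  where r = |\<xi>|^(1-p). The remainder's factorial absorbs n^n up to e^n, so the constant is
  purely geometric in \<open>n\<close>; the factor \<open>r ^ n\<close> moves to the left-hand
  side.\<close>

lemma fourier_le_zero_gaps:
  assumes gaps: "zero_gaps (fourier g) p C" and p: "p > 1" and C: "C > 0" and \<xi>: "\<bar>\<xi>\<bar> \<ge> 1"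
    and g: "integrable lborel g" and mom: "integrable lborel (\<lambda>x. \<bar>x\<bar> ^ n * cmod (g x))"
  shows "\<bar>\<xi>\<bar> powr ((p - 1) * n) * cmod (fourier g \<xi>)
           \<le> (6 * pi * exp 1 * C) ^ n * (\<integral>x. \<bar>x\<bar> ^ n * cmod (g x) \<partial>lborel)"
proof -
  define I where "I = (\<integral>x. \<bar>x\<bar> ^ n * cmod (g x) \<partial>lborel)"
  define r where "r = \<bar>\<xi>\<bar> powr (1 - p)"
  have I: "I \<ge> 0" unfolding I_def by (intro integral_nonneg_AE) auto
  obtain Z where Z: "finite Z" "card Z = n" "\<And>z. z \<in> Z \<Longrightarrow> fourier g z = 0"
    and near: "\<And>z. z \<in> Z \<Longrightarrow> \<bar>\<xi> - z\<bar> \<le> 3 * real n * (C * r)"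
    using zero_gaps_finite_set[OF gaps p C \<xi>, of n] unfolding r_def by blast
  have "(\<Prod>z\<in>Z. \<bar>\<xi> - z\<bar>) \<le> (\<Prod>z\<in>Z. 3 * real n * (C * r))"
    by (intro prod_mono conjI abs_ge_zero near)
  also have "\<dots> = (3 * C * r) ^ n * real n ^ n"
    by (simp add: Z(2) power_mult_distrib)
  also have "\<dots> \<le> (3 * C * r) ^ n * (fact n * exp (real n))"
    using C by (intro mult_left_mono power_le_fact_exp) (auto simp: r_def)
  also have "\<dots> = (3 * C * r * exp 1) ^ n * fact n"
    by (simp add: power_mult_distrib flip: exp_of_nat_mult)
  finally have "(\<Prod>z\<in>Z. \<bar>\<xi> - z\<bar>) / fact n \<le> (3 * C * r * exp 1) ^ n"
    by (simp add: pos_divide_le_eq)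
  then have "(2 * pi) ^ n * ((\<Prod>z\<in>Z. \<bar>\<xi> - z\<bar>) / fact n) * I \<le> (2 * pi) ^ n * (3 * C * r * exp 1) ^ n * I"
    using I by (intro mult_right_mono mult_left_mono) auto
  then have "cmod (fourier g \<xi>) \<le> (2 * pi) ^ n * (3 * C * r * exp 1) ^ n * I"
    using fourier_le_moment[OF g mom Z, of \<xi>] by (simp add: I_def)
  also have "\<dots> = (6 * pi * exp 1 * C) ^ n * I * r ^ n"
  proof -
    have "(2 * pi) * (3 * C * r * exp 1) = (6 * pi * exp 1 * C) * r" by simp
    then have "(2 * pi) ^ n * (3 * C * r * exp 1) ^ n = (6 * pi * exp 1 * C) ^ n * r ^ n"
      by (simp only: power_mult_distrib[symmetric])
    then show ?thesis by (simp only: mult_ac)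
  qed
  finally have "\<bar>\<xi>\<bar> powr ((p - 1) * n) * cmod (fourier g \<xi>)
      \<le> \<bar>\<xi>\<bar> powr ((p - 1) * n) * ((6 * pi * exp 1 * C) ^ n * I * r ^ n)"
    by (rule mult_left_mono) simp
  also have "\<dots> = (6 * pi * exp 1 * C) ^ n * I * (\<bar>\<xi>\<bar> powr ((p - 1) * n) * r ^ n)"
    by (simp add: mult_ac)
  also have "\<bar>\<xi>\<bar> powr ((p - 1) * n) * r ^ n = 1"
    using \<xi> by (simp add: r_def powr_power flip: powr_add) (simp add: algebra_simps)
  finally show ?thesis by (simp add: I_def)
qed

section \<open>Moments of decaying functions and the resulting decay of the transform\<close>

lemma integrable_lborel_inverse_1_plus_square: "integrable lborel (\<lambda>x::real. inverse (1 + x\<^sup>2))"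
  and integral_lborel_inverse_1_plus_square: "(\<integral>x. inverse (1 + x\<^sup>2) \<partial>lborel) = pi"
  using integrable_inverse_1_plus_square LBINT_inverse_1_plus_square
  by (simp_all add: set_integrable_def interval_lebesgue_integral_def set_lebesgue_integral_def)

text \<open>Two extra orders of decay pay for integrability: 1 + x^2 \<le> 2 max(1,|x|)^2 gives
  domination by a multiple of 1/(1 + x^2), whose integral is \<open>pi\<close>.\<close>

lemma decays_moment:
  assumes g: "g \<in> borel_measurable borel" and dec: "decays g m D" and m: "m \<ge> real n + 2"
  shows "integrable lborel (\<lambda>x. \<bar>x\<bar> ^ n * cmod (g x))"
    and "(\<integral>x. \<bar>x\<bar> ^ n * cmod (g x) \<partial>lborel) \<le> 2 * pi * D"
proof -
  have le: "\<bar>x\<bar> ^ n * cmod (g x) \<le> 2 * D * inverse (1 + x\<^sup>2)" for x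
  proof -
    define M where "M = max 1 \<bar>x\<bar>"
    have M: "M \<ge> 1" "\<bar>x\<bar> \<le> M" by (auto simp: M_def)
    have "1 + x\<^sup>2 \<le> 2 * M\<^sup>2"
    proof -
      have "x\<^sup>2 \<le> M\<^sup>2" using power_mono[OF M(2), of 2] by simp
      moreover have "1 \<le> M\<^sup>2" by (rule one_le_power[OF M(1)])
      ultimately show ?thesis by linarith
    qed
    moreover have "\<bar>x\<bar> ^ n \<le> M ^ n" using M by (intro power_mono) auto
    ultimately have "\<bar>x\<bar> ^ n * cmod (g x) * (1 + x\<^sup>2) \<le> M ^ n * cmod (g x) * (2 * M\<^sup>2)"
      using M by (intro mult_mono) auto
    also have "\<dots> = 2 * (M powr (real n + 2) * cmod (g x))"
    proof -
      have "M powr (real n + 2) = M ^ n * M\<^sup>2"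
        using M powr_realpow[of M "n + 2"] by (simp only: of_nat_add power_add of_nat_numeral)
      then show ?thesis by simp
    qed
    also have "\<dots> \<le> 2 * D"
      using decays_mono[OF dec m] unfolding decays_def M_def by auto
    finally show ?thesis
      by (simp add: field_simps add_pos_nonneg)
  qed
  have int: "integrable lborel (\<lambda>x. 2 * D * inverse (1 + x\<^sup>2))"
    using integrable_lborel_inverse_1_plus_square by simp
  show *: "integrable lborel (\<lambda>x. \<bar>x\<bar> ^ n * cmod (g x))"
    by (rule Bochner_Integration.integrable_bound[OF int])
       (use g le in \<open>auto intro!: AE_I2 order.trans[OF _ abs_ge_self]\<close>)
  have "(\<integral>x. \<bar>x\<bar> ^ n * cmod (g x) \<partial>lborel) \<le> (\<integral>x. 2 * D * inverse (1 + x\<^sup>2) \<partial>lborel)"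
    using int * le by (intro integral_mono) auto
  then show "(\<integral>x. \<bar>x\<bar> ^ n * cmod (g x) \<partial>lborel) \<le> 2 * pi * D"
    by (simp add: integral_lborel_inverse_1_plus_square mult_ac)
qed

lemma decays_integrable:
  assumes "g \<in> borel_measurable borel" and "decays g m D" and "m \<ge> 2"
  shows "integrable lborel g"
  using decays_moment(1)[of g m D 0] assms by (auto simp: integrable_norm_iff)

lemma fourier_norm_le:
  assumes "integrable lborel g"
  shows "cmod (fourier g \<xi>) \<le> (\<integral>x. cmod (g x) \<partial>lborel)"
proof -
  have "cmod (fourier g \<xi>) \<le> (\<integral>x. cmod (g x * cis (2 * pi * x * \<xi>)) \<partial>lborel)"
    unfolding fourier_altdef by (rule integral_norm_bound)
  then show ?thesis by (simp add: norm_mult)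
qed

lemma decays_fourier:
  assumes gaps: "zero_gaps (fourier g) p C" and p: "p > 1" and C: "C > 0"
    and g: "g \<in> borel_measurable borel" and dec: "decays g (real n + 2) D" and n: "n \<ge> 1"
    and K: "K \<ge> 2 * pi * max 1 (6 * pi * exp 1 * C)"
  shows "decays (fourier g) ((p - 1) * n) (K ^ n * D)"
  unfolding decays_def
proof
  fix \<xi>
  have D: "D \<ge> 0" using decays_nonneg[OF dec] .
  have int: "integrable lborel g" using decays_integrable[OF g dec] by simp
  define c where "c = 6 * pi * exp 1 * C"
  \<comment> \<open>Here \<open>n \<ge> 1\<close> lets the single factor \<open>2 * pi\<close> from
    the moment bound be absorbed into \<open>K ^ n\<close>.\<close>
  have "2 * pi * max 1 c ^ n \<le> (2 * pi) ^ n * max 1 c ^ n"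
    using n pi_ge_two power_increasing[of 1 n "2 * pi"] by (intro mult_right_mono) auto
  also have "\<dots> \<le> K ^ n"
    unfolding power_mult_distrib[symmetric] using K by (intro power_mono) (auto simp: c_def)
  finally have K: "max 1 c ^ n * (2 * pi * D) \<le> K ^ n * D"
    using mult_right_mono[OF _ D] by (fastforce simp: mult_ac)
  show "max 1 \<bar>\<xi>\<bar> powr ((p - 1) * n) * cmod (fourier g \<xi>) \<le> K ^ n * D"
  proof (cases "\<bar>\<xi>\<bar> \<ge> 1")
    case True
    have "c ^ n * (\<integral>x. \<bar>x\<bar> ^ n * cmod (g x) \<partial>lborel) \<le> max 1 c ^ n * (2 * pi * D)"
      using decays_moment(2)[OF g dec] C
      by (intro mult_mono power_mono integral_nonneg_AE) (auto simp: c_def)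
    moreover have "integrable lborel (\<lambda>x. \<bar>x\<bar> ^ n * cmod (g x))"
      using decays_moment(1)[OF g dec] by simp
    note fourier_le_zero_gaps[OF gaps p C True int this]
    ultimately show ?thesis
      using True K by (simp add: c_def max_absorb2)
  next
    \<comment> \<open>Near the origin the weight is 1, and the bound of the transform by the L1 norm
      suffices.\<close>
    case False
    have "cmod (fourier g \<xi>) \<le> 2 * pi * D"
      using fourier_norm_le[OF int, of \<xi>] decays_moment(2)[OF g dec, of 0] by simp
    also have "\<dots> \<le> max 1 c ^ n * (2 * pi * D)"
      using D mult_right_mono[OF one_le_power[of "max 1 c" n], of "2 * pi * D"] by simp
    finally show ?thesis using K False by (simp add: max_absorb1)
  qed
qed

subsection \<open>Fourier inversion\<close>

text \<open>The left-hand side is the characteristic function of the standard normal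
  distribution.\<close>

lemma integral_std_normal_density_cis:
  "(\<integral>u. of_real (std_normal_density u) * cis (t * u) \<partial>lborel) = of_real (exp (- t\<^sup>2 / 2))"
proof -
  have "char std_normal_distribution t = (\<integral>u. std_normal_density u *\<^sub>R iexp (t * u) \<partial>lborel)"
    unfolding char_def by (subst integral_density) auto
  then show ?thesis
    by (simp add: char_std_normal_distribution cis_conv_exp scaleR_conv_of_real)
qed

text \<open>Substitute u = \<epsilon>\<xi> in the characteristic function. The right-hand side is
  the centred normal density with standard deviation \<epsilon>/(2\<pi>), an approximate identity as
  \<epsilon> tends to 0.\<close>

lemma fourier_scaled_gaussian:
  assumes "\<epsilon> > 0"
  shows "(\<integral>\<xi>. of_real (exp (- (\<epsilon> * \<xi>)\<^sup>2 / 2)) * cis (2 * pi * s * \<xi>) \<partial>lborel)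
           = of_real (2 * pi / \<epsilon> * std_normal_density (2 * pi / \<epsilon> * s))"
proof -
  have "of_real (exp (- (2 * pi * s / \<epsilon>)\<^sup>2 / 2)) =
      (\<integral>u. of_real (std_normal_density u) * cis (2 * pi * s / \<epsilon> * u) \<partial>lborel)"
    by (rule integral_std_normal_density_cis[symmetric])
  also have "\<dots> = \<bar>\<epsilon>\<bar> *\<^sub>R (\<integral>\<xi>. of_real (std_normal_density (0 + \<epsilon> * \<xi>)) *
      cis (2 * pi * s / \<epsilon> * (0 + \<epsilon> * \<xi>)) \<partial>lborel)"
    using assms by (intro lborel_integral_real_affine) auto
  also have "\<dots> = of_real \<epsilon> * (\<integral>\<xi>. of_real (1 / sqrt (2 * pi)) *
      (of_real (exp (- (\<epsilon> * \<xi>)\<^sup>2 / 2)) * cis (2 * pi * s * \<xi>)) \<partial>lborel)"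
    using assms by (simp add: std_normal_density_def scaleR_conv_of_real mult_ac)
  also have "\<dots> = of_real (\<epsilon> / sqrt (2 * pi)) *
      (\<integral>\<xi>. of_real (exp (- (\<epsilon> * \<xi>)\<^sup>2 / 2)) * cis (2 * pi * s * \<xi>) \<partial>lborel)"
    by (subst integral_mult_right_zero) simp
  finally have "(\<integral>\<xi>. of_real (exp (- (\<epsilon> * \<xi>)\<^sup>2 / 2)) * cis (2 * pi * s * \<xi>) \<partial>lborel)
      = of_real (sqrt (2 * pi) / \<epsilon> * exp (- (2 * pi * s / \<epsilon>)\<^sup>2 / 2))"
    using assms by (simp add: field_simps)
  also have "sqrt (2 * pi) / \<epsilon> * exp (- (2 * pi * s / \<epsilon>)\<^sup>2 / 2)
      = 2 * pi / \<epsilon> * std_normal_density (2 * pi / \<epsilon> * s)"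
  proof -
    have "sqrt (2 * pi) / \<epsilon> * E = 2 * pi / \<epsilon> * (1 / sqrt (2 * pi) * E)" for E
      using real_div_sqrt[of "2 * pi"] by (simp add: divide_simps)
    moreover have "2 * pi / \<epsilon> * s = 2 * pi * s / \<epsilon>" by simp
    ultimately show ?thesis by (simp only: std_normal_density_def)
  qed
  finally show ?thesis .
qed

lemma integrable_scaled_gaussian:
  assumes "\<epsilon> > 0"
  shows "integrable lborel (\<lambda>\<xi>::real. exp (- (\<epsilon> * \<xi>)\<^sup>2 / 2))"
proof -
  have "integrable lborel (\<lambda>\<xi>. sqrt (2 * pi) * std_normal_density (0 + \<epsilon> * \<xi>))"
    using assms by (intro integrable_mult_right lborel_integrable_real_affine integrable_normal_density) auto
  then show ?thesis by (simp add: std_normal_density_def)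
qed

lemma borel_measurable_fourier:
  assumes "g \<in> borel_measurable borel"
  shows "fourier g \<in> borel_measurable borel"
proof -
  have [measurable]: "g \<in> borel_measurable borel" by fact
  show ?thesis unfolding fourier_def[abs_def] by measurable
qed

text \<open>The Gaussian factor makes the double integral absolutely convergent, so Fubini applies
  even when the transform is not integrable. Integrating over \<open>\<xi>\<close> first leaves an
  average of \<open>g\<close> against a narrow normal density around \<open>- x\<close>.\<close>

lemma fourier_fourier_gaussian_mean:
  assumes g: "g \<in> borel_measurable borel" "integrable lborel g" and \<epsilon>: "\<epsilon> > 0"
  shows "(\<integral>\<xi>. of_real (exp (- (\<epsilon> * \<xi>)\<^sup>2 / 2)) * (fourier g \<xi> * cis (2 * pi * \<xi> * x)) \<partial>lborel)
           = (\<integral>u. of_real (std_normal_density u) * g (- x + \<epsilon> / (2 * pi) * u) \<partial>lborel)"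
proof -
  have [measurable]: "g \<in> borel_measurable borel" by fact
  define \<gamma> where "\<gamma> = (\<lambda>\<xi>. exp (- (\<epsilon> * \<xi>)\<^sup>2 / 2))"
  define F where "F = (\<lambda>y \<xi>. of_real (\<gamma> \<xi>) * (g y * cis (2 * pi * (y + x) * \<xi>)))"
  have [measurable]: "\<gamma> \<in> borel_measurable borel" unfolding \<gamma>_def by measurable
  have \<gamma>: "integrable lborel \<gamma>" using integrable_scaled_gaussian[OF \<epsilon>] by (simp add: \<gamma>_def)
  \<comment> \<open>The norm factors into two integrable functions of one variable each, which is
    what Fubini requires.\<close>
  have normF: "cmod (F y \<xi>) = cmod (g y) * \<gamma> \<xi>" for y \<xi>
    by (simp add: F_def norm_mult \<gamma>_def)
  have meas: "case_prod F \<in> borel_measurable (lborel \<Otimes>\<^sub>M lborel)"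
    unfolding F_def cis_conv_exp by measurable
  have "integrable (lborel \<Otimes>\<^sub>M lborel) (case_prod F)"
  proof (rule lborel_pair.Fubini_integrable[OF meas])
    show "integrable lborel (\<lambda>y. \<integral>\<xi>. norm (case_prod F (y, \<xi>)) \<partial>lborel)"
      using g(2) by (simp add: normF)
    have "integrable lborel (F y)" for y
    proof (rule Bochner_Integration.integrable_bound)
      show "integrable lborel (\<lambda>\<xi>. cmod (g y) * \<gamma> \<xi>)" using \<gamma> by simp
      show "F y \<in> borel_measurable lborel" unfolding F_def cis_conv_exp by measurable
      show "AE \<xi> in lborel. cmod (F y \<xi>) \<le> norm (cmod (g y) * \<gamma> \<xi>)"
        by (simp add: normF)
    qed
    then show "AE y in lborel. integrable lborel (\<lambda>\<xi>. case_prod F (y, \<xi>))" by simp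
  qed
  note Fubini = lborel_pair.Fubini_integral[OF this]
  have "(\<integral>\<xi>. of_real (\<gamma> \<xi>) * (fourier g \<xi> * cis (2 * pi * \<xi> * x)) \<partial>lborel)
      = (\<integral>\<xi>. (\<integral>y. F y \<xi> \<partial>lborel) \<partial>lborel)"
  proof (intro Bochner_Integration.integral_cong refl)
    fix \<xi>
    have "(\<integral>y. F y \<xi> \<partial>lborel)
        = (\<integral>y. (of_real (\<gamma> \<xi>) * cis (2 * pi * \<xi> * x)) * (g y * cis (2 * pi * y * \<xi>)) \<partial>lborel)"
      by (intro Bochner_Integration.integral_cong refl)
         (simp add: F_def algebra_simps cis_mult[symmetric])
    then show "of_real (\<gamma> \<xi>) * (fourier g \<xi> * cis (2 * pi * \<xi> * x)) = (\<integral>y. F y \<xi> \<partial>lborel)"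
      by (simp add: fourier_altdef)
  qed
  also have "\<dots> = (\<integral>y. (\<integral>\<xi>. F y \<xi> \<partial>lborel) \<partial>lborel)" by (rule Fubini)
  also have "\<dots> = (\<integral>y. g y * of_real (2 * pi / \<epsilon> * std_normal_density (2 * pi / \<epsilon> * (y + x))) \<partial>lborel)"
  proof (intro Bochner_Integration.integral_cong refl)
    fix y
    have "(\<integral>\<xi>. F y \<xi> \<partial>lborel) = (\<integral>\<xi>. g y * (of_real (\<gamma> \<xi>) * cis (2 * pi * (y + x) * \<xi>)) \<partial>lborel)"
      by (simp add: F_def mult_ac)
    then show "(\<integral>\<xi>. F y \<xi> \<partial>lborel) = g y * of_real (2 * pi / \<epsilon> * std_normal_density (2 * pi / \<epsilon> * (y + x)))"
      using fourier_scaled_gaussian[OF \<epsilon>, of "y + x"] by (simp add: \<gamma>_def)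
  qed
  \<comment> \<open>Substitution y = -x + (\<epsilon>/(2\<pi>)) u, which rescales the density to the
    standard one.\<close>
  also have "\<dots> = \<bar>\<epsilon> / (2 * pi)\<bar> *\<^sub>R (\<integral>u. g (- x + \<epsilon> / (2 * pi) * u) *
      of_real (2 * pi / \<epsilon> * std_normal_density (2 * pi / \<epsilon> * ((- x + \<epsilon> / (2 * pi) * u) + x))) \<partial>lborel)"
    using \<epsilon> by (intro lborel_integral_real_affine) auto
  also have "\<dots> = \<bar>\<epsilon> / (2 * pi)\<bar> *\<^sub>R (\<integral>u. of_real (2 * pi / \<epsilon>) *
      (of_real (std_normal_density u) * g (- x + \<epsilon> / (2 * pi) * u)) \<partial>lborel)"
    using \<epsilon> by (intro arg_cong[where f = "\<lambda>t. _ *\<^sub>R t"] Bochner_Integration.integral_cong refl)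
       (simp add: mult_ac)
  also have "\<dots> = (\<integral>u. of_real (std_normal_density u) * g (- x + \<epsilon> / (2 * pi) * u) \<partial>lborel)"
    using \<epsilon> by (subst integral_mult_right_zero) (simp add: scaleR_conv_of_real)
  finally show ?thesis unfolding \<gamma>_def .
qed

text \<open>Let \<epsilon> tend to 0 in \<open>fourier_fourier_gaussian_mean\<close>. Dominated
  convergence applies to both sides, with majorant |fourier g| on the left and \<open>B\<close>
  times the normal density on the right. Both transforms have the same sign in the kernel, hence the
  reflection.\<close>

theorem fourier_inversion:
  assumes cont: "continuous_on UNIV g" and bound: "\<And>x. cmod (g x) \<le> B"
    and g: "integrable lborel g" and Fg: "integrable lborel (fourier g)"
  shows "fourier (fourier g) x = g (- x)"
proof -
  have meas[measurable]: "g \<in> borel_measurable borel"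
    using cont by (simp add: borel_measurable_continuous_onI)
  have [measurable]: "fourier g \<in> borel_measurable borel"
    by (rule borel_measurable_fourier[OF meas])
  define \<epsilon> where "\<epsilon> = (\<lambda>n. inverse (real (Suc n)))"
  have \<epsilon>: "\<epsilon> \<longlonglongrightarrow> 0" unfolding \<epsilon>_def by (rule LIMSEQ_inverse_real_of_nat)
  have "(\<lambda>n. \<integral>\<xi>. of_real (exp (- (\<epsilon> n * \<xi>)\<^sup>2 / 2)) * (fourier g \<xi> * cis (2 * pi * \<xi> * x)) \<partial>lborel)
      \<longlonglongrightarrow> (\<integral>\<xi>. fourier g \<xi> * cis (2 * pi * \<xi> * x) \<partial>lborel)"
  proof (rule integral_dominated_convergence[where w = "\<lambda>\<xi>. cmod (fourier g \<xi>)"])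
    show "AE \<xi> in lborel. (\<lambda>n. of_real (exp (- (\<epsilon> n * \<xi>)\<^sup>2 / 2)) * (fourier g \<xi> * cis (2 * pi * \<xi> * x)))
        \<longlonglongrightarrow> fourier g \<xi> * cis (2 * pi * \<xi> * x)"
      by (rule AE_I2) (auto intro!: tendsto_eq_intros \<epsilon>)
    show "AE \<xi> in lborel. norm (of_real (exp (- (\<epsilon> n * \<xi>)\<^sup>2 / 2)) * (fourier g \<xi> * cis (2 * pi * \<xi> * x)))
        \<le> cmod (fourier g \<xi>)" for n
      by (rule AE_I2) (simp add: norm_mult mult_left_le_one_le)
  qed (use Fg in \<open>auto simp: cis_conv_exp\<close>)
  moreover have "(\<lambda>n. \<integral>u. of_real (std_normal_density u) * g (- x + \<epsilon> n / (2 * pi) * u) \<partial>lborel)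
      \<longlonglongrightarrow> (\<integral>u. of_real (std_normal_density u) * g (- x) \<partial>lborel)"
  proof (rule integral_dominated_convergence[where w = "\<lambda>u. std_normal_density u * B"])
    have lim: "(\<lambda>n. - x + \<epsilon> n / (2 * pi) * u) \<longlonglongrightarrow> - x" for u
      by (auto intro!: tendsto_eq_intros \<epsilon>)
    have "isCont g (- x)" using cont by (simp add: continuous_on_eq_continuous_at)
    then have "(\<lambda>n. g (- x + \<epsilon> n / (2 * pi) * u)) \<longlonglongrightarrow> g (- x)" for u
      using lim by (rule isCont_tendsto_compose)
    then show "AE u in lborel. (\<lambda>n. of_real (std_normal_density u) * g (- x + \<epsilon> n / (2 * pi) * u))
        \<longlonglongrightarrow> of_real (std_normal_density u) * g (- x)"
      by (intro AE_I2 tendsto_mult tendsto_const)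
    show "AE u in lborel. norm (of_real (std_normal_density u) * g (- x + \<epsilon> n / (2 * pi) * u))
        \<le> std_normal_density u * B" for n
      using bound by (intro AE_I2) (simp add: norm_mult mult_left_mono)
  qed (auto intro!: integrable_mult_left)
  moreover have "(\<integral>u. of_real (std_normal_density u) * g (- x) \<partial>lborel) = g (- x)"
    using integral_std_normal_density_cis[of 0] by simp
  moreover have "\<epsilon> n > 0" for n by (simp add: \<epsilon>_def)
  ultimately show ?thesis
    unfolding fourier_altdef[of "fourier g"]
    by (metis (no_types, lifting) LIMSEQ_unique fourier_fourier_gaussian_mean[OF meas g] ext)
qed

subsection \<open>Uniqueness\<close>

text \<open>(r/t)^n tends to 0. The estimate is assumed only for arbitrarily large \<open>n\<close>,
  since the iteration reaches an unbounded set of orders rather than all of them.\<close>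

lemma geometric_domination_zero:
  fixes a r t B :: real
  assumes "\<And>N. \<exists>n\<ge>N. t ^ n * a \<le> r ^ n * B" and "0 \<le> r" and "r < t" and "0 \<le> a"
  shows "a = 0"
proof (rule ccontr)
  assume "a \<noteq> 0"
  then have a: "a > 0" using assms by simp
  have "(\<lambda>n. (r / t) ^ n * B) \<longlonglongrightarrow> 0 * B"
    using assms by (intro tendsto_mult tendsto_const LIMSEQ_power_zero) auto
  then have "eventually (\<lambda>n. (r / t) ^ n * B < a) sequentially"
    using a by (intro order_tendstoD(2)[where y = 0]) auto
  then obtain N where N: "\<And>n. n \<ge> N \<Longrightarrow> (r / t) ^ n * B < a"
    by (auto simp: eventually_sequentially)
  obtain n where "n \<ge> N" "t ^ n * a \<le> r ^ n * B" using assms(1) by blast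
  with N[of n] assms show False by (simp add: power_divide field_simps)
qed

text \<open>Decay of order \<open>y\<close> controls integer moments of order \<open>n\<close> with
  \<open>n + 2 \<le> y\<close>; rounding down to such an \<open>n\<close> loses at most 3.\<close>

lemma nat_between:
  fixes y :: real
  assumes "y \<ge> 3"
  obtains n :: nat where "n \<ge> 1" "y - 3 \<le> n" "real n + 2 \<le> y"
proof (rule that)
  have "\<lfloor>y\<rfloor> \<ge> 3" using assms by linarith
  then show "nat (\<lfloor>y\<rfloor> - 2) \<ge> 1" "y - 3 \<le> real (nat (\<lfloor>y\<rfloor> - 2))"
    "real (nat (\<lfloor>y\<rfloor> - 2)) + 2 \<le> y"
    by linarith+
qed

text \<open>
  A step sends the order \<open>n\<close> to roughly \<open>(p - 1) * n\<close> for the Fourier transform, and back to roughly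
  \<open>(p - 1) * (q - 1) * n\<close>. Since the orders grow geometrically, the total number of factors \<open>K\<close> that
  are picked up stays linear in the current order.
\<close>

lemma zero_gaps_imp_compact_support:
  assumes cont: "continuous_on UNIV g" and dec: "\<And>m. \<exists>D. decays g m D"
    and gaps1: "zero_gaps (fourier g) p C1" and gaps2: "zero_gaps (fourier (fourier g)) q C2"
    and inv: "\<And>x. fourier (fourier g) x = g (- x)"
    and p: "p > 1" and q: "q > 1" and pq: "(p - 1) * (q - 1) > 1" and C: "C1 > 0" "C2 > 0"
  shows "\<exists>A\<ge>1. \<forall>x. \<bar>x\<bar> > A \<longrightarrow> g x = 0"
proof -
  have meas: "g \<in> borel_measurable borel"
    using cont by (simp add: borel_measurable_continuous_onI)
  have measF: "fourier g \<in> borel_measurable borel"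
    by (rule borel_measurable_fourier[OF meas])
  define K where "K = max (2 * pi * max 1 (6 * pi * exp 1 * C1)) (2 * pi * max 1 (6 * pi * exp 1 * C2))"
  have K: "K \<ge> 2 * pi * max 1 (6 * pi * exp 1 * C1)" "K \<ge> 2 * pi * max 1 (6 * pi * exp 1 * C2)"
    by (auto simp: K_def)
  have "1 * 1 \<le> 2 * pi * max 1 (6 * pi * exp 1 * C1)"
    using pi_ge_two by (intro mult_mono) auto
  with K have K1: "K \<ge> 1" by linarith
  \<comment> \<open>Half of the excess of (p-1)(q-1) over 1. One share \<open>\<eta> * n\<close> is
    the guaranteed gain in order per round trip, the other covers the losses from rounding.\<close>
  define \<eta> where "\<eta> = ((p - 1) * (q - 1) - 1) / 2"
  have "2 * \<eta> = (p - 1) * (q - 1) - 1" by (simp add: \<eta>_def)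
  with pq have \<eta>: "\<eta> > 0" "(p - 1) * (q - 1) = 1 + 2 * \<eta>" by linarith+
  \<comment> \<open>A round trip costs \<open>m + n \<le> p * n\<close> factors of \<open>K\<close>
    and raises the order by at least \<open>\<eta> * n\<close>. With \<open>R * \<eta> = p\<close>
    the exponent \<open>R * n\<close> of \<open>K\<close> grows fast enough to pay for them.\<close>
  define R where "R = p / \<eta>"
  have R: "R > 0" "R * \<eta> = p" using \<eta> p by (auto simp: R_def)
  \<comment> \<open>The three bounds ensure \<open>n \<ge> 1\<close>, an order
    \<open>(p - 1) * n\<close> large enough for \<open>nat_between\<close>, and
    \<open>\<eta> * n \<ge> 3 * q\<close> to cover the rounding loss.\<close>
  obtain n0 :: nat where n0: "real n0 \<ge> max 1 (max (4 / (p - 1)) (3 * q / \<eta>))"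
    using real_arch_simple by blast
  obtain D where D: "decays g (real n0 + 2) D" using dec by blast
  define good where "good = (\<lambda>n::nat. n \<ge> n0 \<and> decays g (real n + 2) (K powr (R * n) * D))"
  have D0: "D \<ge> 0" using decays_nonneg[OF D] .
  have start: "good n0"
  proof -
    have "1 * D \<le> K powr (R * n0) * D"
      using K1 R D0 by (intro mult_right_mono ge_one_powr_ge_zero) auto
    with D show ?thesis unfolding good_def decays_def by (auto intro: order.trans)
  qed
  have step: "\<exists>n'>n. good n'" if "good n" for n
  proof -
    have n: "n \<ge> n0" "decays g (real n + 2) (K powr (R * n) * D)" using that by (auto simp: good_def)
    then have n_ge: "n \<ge> 1" "real n \<ge> 4 / (p - 1)" "real n \<ge> 3 * q / \<eta>"
      using n0 of_nat_mono[OF n(1), where 'a = real] by auto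
    then have n_ge: "n \<ge> 1" "(p - 1) * n \<ge> 4" "\<eta> * n \<ge> 3 * q"
      using p \<eta>(1) by (simp_all add: pos_divide_le_eq mult.commute)
    obtain m :: nat where m: "m \<ge> 1" "(p - 1) * n - 3 \<le> m" "real m + 2 \<le> (p - 1) * n"
      using nat_between[of "(p - 1) * n"] n_ge by auto
    have "(q - 1) * ((p - 1) * n - 3) \<le> (q - 1) * m"
      using m q by (intro mult_left_mono) auto
    moreover have "(q - 1) * ((p - 1) * n - 3) = n + 2 * (\<eta> * n) - 3 * q + 3"
    proof -
      have "(q - 1) * ((p - 1) * n - 3) = ((p - 1) * (q - 1)) * n - 3 * q + 3"
        by (simp add: algebra_simps)
      then show ?thesis unfolding \<eta>(2) by (simp add: algebra_simps)
    qed
    ultimately have qm: "(q - 1) * m \<ge> n + \<eta> * n + 3" using n_ge by linarith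
    moreover have "0 \<le> \<eta> * n" using \<eta>(1) by simp
    ultimately have "(q - 1) * m \<ge> 3" by linarith
    then obtain n' :: nat where n': "(q - 1) * m - 3 \<le> n'" "real n' + 2 \<le> (q - 1) * m"
      using nat_between by blast
    have "decays (fourier g) ((p - 1) * n) (K ^ n * (K powr (R * n) * D))"
      by (rule decays_fourier[OF gaps1 p C(1) meas n(2) n_ge(1) K(1)])
    then have "decays (fourier g) (real m + 2) (K ^ n * (K powr (R * n) * D))"
      using m by (auto intro: decays_mono)
    then have "decays (fourier (fourier g)) ((q - 1) * m) (K ^ m * (K ^ n * (K powr (R * n) * D)))"
      by (rule decays_fourier[OF gaps2 q C(2) measF _ m(1) K(2)])
    then have "decays (fourier (fourier g)) (real n' + 2) (K ^ m * (K ^ n * (K powr (R * n) * D)))"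
      using n' by (auto intro: decays_mono)
    then have dec': "decays g (real n' + 2) (K ^ m * (K ^ n * (K powr (R * n) * D)))"
      unfolding decays_def inv by (metis abs_minus_cancel minus_minus)
    have gt: "n' \<ge> n + \<eta> * n" using n' qm by linarith
    have "K ^ m * (K ^ n * (K powr (R * n) * D)) = K powr (real m + real n + R * n) * D"
      using K1 by (simp add: powr_add powr_realpow)
    also have "\<dots> \<le> K powr (R * n') * D"
    proof (intro mult_right_mono powr_mono K1 D0)
      have "R * (n + \<eta> * n) \<le> R * n'" using gt R by (intro mult_left_mono) auto
      moreover have "R * (n + \<eta> * n) = R * n + p * n" using R(2) by (simp add: algebra_simps)
      moreover have "real m + n \<le> p * n" using m(3) by (simp add: algebra_simps)
      ultimately show "real m + n + R * n \<le> R * n'" by linarith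
    qed
    finally have "decays g (real n' + 2) (K powr (R * n') * D)"
      using dec' unfolding decays_def by (auto intro: order.trans)
    moreover have "n' > n"
    proof -
      have "\<eta> * n > 0" using \<eta> n_ge by auto
      with gt show ?thesis by linarith
    qed
    ultimately show ?thesis using n(1) unfolding good_def by (intro exI[of _ n']) auto
  qed
  have unbounded: "\<exists>n\<ge>N. good n" for N
  proof (induction N)
    case 0
    show ?case using start by blast
  next
    case (Suc N)
    then show ?case using step by (meson Suc_le_eq le_less_trans)
  qed
  \<comment> \<open>The bounds for good orders now read \<open>A ^ n * D\<close>, so beyond radius
    \<open>A\<close> geometric domination forces \<open>g\<close> to vanish.\<close>
  define A where "A = K powr R"
  have A: "A \<ge> 1" unfolding A_def using K1 R by (intro ge_one_powr_ge_zero) auto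
  have "g x = 0" if x: "\<bar>x\<bar> > A" for x
  proof -
    have "\<exists>n\<ge>N. \<bar>x\<bar> ^ n * cmod (g x) \<le> A ^ n * D" for N
    proof -
      obtain n where n: "n \<ge> N" "good n" using unbounded by blast
      have "\<bar>x\<bar> ^ n * cmod (g x) \<le> \<bar>x\<bar> powr (real n + 2) * cmod (g x)"
        using x A powr_mono[of "real n" "real n + 2" "\<bar>x\<bar>"]
        by (intro mult_right_mono) (auto simp: powr_realpow)
      also have "\<dots> \<le> K powr (R * n) * D"
      proof -
        have "max 1 \<bar>x\<bar> = \<bar>x\<bar>" using x A by simp
        then show ?thesis using n(2) unfolding good_def decays_def by metis
      qed
      also have "K powr (R * n) = A ^ n"
        using K1 by (simp add: A_def powr_power mult.commute)
      finally show ?thesis using n(1) by blast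
    qed
    then have "cmod (g x) = 0"
      using x A by (intro geometric_domination_zero[of "\<bar>x\<bar>" _ A D]) auto
    then show ?thesis by simp
  qed
  with A show ?thesis by blast
qed

section \<open>Functions of compact support\<close>

lemma compact_support_moment:
  assumes g: "integrable lborel g" and A: "A \<ge> 0" and supp: "\<And>x. \<bar>x\<bar> > A \<Longrightarrow> g x = 0"
  shows "integrable lborel (\<lambda>x. \<bar>x\<bar> ^ n * cmod (g x))"
    and "(\<integral>x. \<bar>x\<bar> ^ n * cmod (g x) \<partial>lborel) \<le> A ^ n * (\<integral>x. cmod (g x) \<partial>lborel)"
proof -
  have le: "\<bar>x\<bar> ^ n * cmod (g x) \<le> A ^ n * cmod (g x)" for x
    using supp[of x] by (cases "\<bar>x\<bar> > A") (auto intro!: mult_right_mono power_mono)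
  have int: "integrable lborel (\<lambda>x. A ^ n * cmod (g x))" using g by simp
  show *: "integrable lborel (\<lambda>x. \<bar>x\<bar> ^ n * cmod (g x))"
    by (rule Bochner_Integration.integrable_bound[OF int])
       (use g le A in \<open>auto simp: abs_mult\<close>)
  show "(\<integral>x. \<bar>x\<bar> ^ n * cmod (g x) \<partial>lborel) \<le> A ^ n * (\<integral>x. cmod (g x) \<partial>lborel)"
    using integral_mono[OF * int le] by simp
qed

text \<open>Moments grow at most like A^n. Hence the gap estimate is geometric and the transform
  vanishes on a half-line. Interpolation at arbitrarily many points of that half-line then replaces
  the identity theorem for the entire extension of the transform.\<close>

lemma compact_support_zero_gaps:
  assumes g: "integrable lborel g" and A: "A \<ge> 0" and supp: "\<And>x. \<bar>x\<bar> > A \<Longrightarrow> g x = 0"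
    and gaps: "zero_gaps (fourier g) p C" and p: "p > 1" and C: "C > 0"
  shows "fourier g \<xi> = 0"
proof -
  define I where "I = (\<integral>x. cmod (g x) \<partial>lborel)"
  define c where "c = 6 * pi * exp 1 * C"
  have c: "c > 0" using C by (simp add: c_def)
  \<comment> \<open>From \<open>B\<close> on, \<open>\<bar>\<xi>\<bar> powr (p - 1)\<close> is at
    least \<open>c * A + 1\<close> and so exceeds the ratio \<open>c * A\<close> of the moment
    bounds.\<close>
  define B where "B = max 1 ((c * A + 1) powr (1 / (p - 1)))"
  note mom = compact_support_moment[OF g A supp, folded I_def]
  have I: "I \<ge> 0" unfolding I_def by (intro integral_nonneg_AE) auto
  have vanish: "fourier g \<xi> = 0" if \<xi>: "\<xi> \<ge> B" for \<xi>
  proof -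
    have \<xi>1: "\<bar>\<xi>\<bar> \<ge> 1" using \<xi> by (auto simp: B_def)
    have le: "(\<bar>\<xi>\<bar> powr (p - 1)) ^ n * cmod (fourier g \<xi>) \<le> (c * A) ^ n * I" for n
    proof -
      have "(\<bar>\<xi>\<bar> powr (p - 1)) ^ n * cmod (fourier g \<xi>) = \<bar>\<xi>\<bar> powr ((p - 1) * n) * cmod (fourier g \<xi>)"
        using \<xi>1 by (simp add: powr_power mult.commute)
      also have "\<dots> \<le> c ^ n * (\<integral>x. \<bar>x\<bar> ^ n * cmod (g x) \<partial>lborel)"
        unfolding c_def by (rule fourier_le_zero_gaps[OF gaps p C \<xi>1 g mom(1)])
      also have "\<dots> \<le> c ^ n * (A ^ n * I)"
        using c by (intro mult_left_mono mom(2)) auto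
      finally show ?thesis by (simp add: power_mult_distrib mult_ac)
    qed
    have "c * A + 1 = ((c * A + 1) powr (1 / (p - 1))) powr (p - 1)"
      using p c A by (simp add: powr_powr)
    also have "\<dots> \<le> \<bar>\<xi>\<bar> powr (p - 1)"
      using \<xi> p by (intro powr_mono2) (auto simp: B_def)
    finally have "cmod (fourier g \<xi>) = 0"
      using le c A by (intro geometric_domination_zero[of "\<bar>\<xi>\<bar> powr (p - 1)" _ "c * A" I]) auto
    then show ?thesis by simp
  qed
  \<comment> \<open>Nodes in \<open>{B..B + 1}\<close> lie within
    \<open>\<bar>\<xi>\<bar> + B + 1\<close> of \<open>\<xi>\<close>, so \<open>n\<close> of them
    give an error of at most a multiple of \<open>w ^ n / fact n\<close>, which tends to 0.\<close>
  define w where "w = 2 * pi * (\<bar>\<xi>\<bar> + B + 1) * A"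
  have bound: "cmod (fourier g \<xi>) \<le> w ^ n / fact n * I" for n
  proof -
    have B: "B \<ge> 1" by (simp add: B_def)
    obtain Z where Z: "Z \<subseteq> {B..B + 1}" "finite Z" "card Z = n"
      using infinite_arbitrarily_large[of "{B..B + 1}" n] by (auto simp: infinite_Icc)
    have near: "\<bar>\<xi> - z\<bar> \<le> \<bar>\<xi>\<bar> + B + 1" if "z \<in> Z" for z
      using that Z(1) B by force
    have "(\<Prod>z\<in>Z. \<bar>\<xi> - z\<bar>) \<le> (\<Prod>z\<in>Z. \<bar>\<xi>\<bar> + B + 1)"
      by (intro prod_mono conjI abs_ge_zero near)
    then have prod_le: "(\<Prod>z\<in>Z. \<bar>\<xi> - z\<bar>) \<le> (\<bar>\<xi>\<bar> + B + 1) ^ n" by (simp add: Z(3))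
    have "cmod (fourier g \<xi>)
        \<le> (2 * pi) ^ n * (\<Prod>z\<in>Z. \<bar>\<xi> - z\<bar>) / fact n * (\<integral>x. \<bar>x\<bar> ^ n * cmod (g x) \<partial>lborel)"
      using Z vanish by (intro fourier_le_moment[OF g mom(1) Z(2,3)]) auto
    also have "\<dots> \<le> (2 * pi) ^ n * (\<bar>\<xi>\<bar> + B + 1) ^ n / fact n * (A ^ n * I)"
      using prod_le mom(2) B
      by (intro mult_mono divide_right_mono mult_left_mono integral_nonneg_AE) auto
    also have "\<dots> = w ^ n / fact n * I"
      by (simp add: w_def power_mult_distrib)
    finally show ?thesis .
  qed
  have "(\<lambda>n. w ^ n /\<^sub>R fact n) \<longlonglongrightarrow> 0"
    by (rule summable_LIMSEQ_zero) (rule summable_exp_generic)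
  then have "(\<lambda>n. w ^ n / fact n * I) \<longlonglongrightarrow> 0"
    by (intro tendsto_mult_left_zero) (simp add: divide_inverse mult.commute)
  then have "cmod (fourier g \<xi>) \<le> 0"
    using bound by (intro LIMSEQ_le_const) auto
  then show ?thesis by simp
qed

theorem fourier_uniqueness_zero_gaps:
  assumes cont: "continuous_on UNIV g" and dec: "\<And>m. \<exists>D. decays g m D"
    and gapsF: "zero_gaps (fourier g) p C1" and gaps: "zero_gaps g q C2"
    and p: "p > 1" and q: "q > 1" and pq: "(p - 1) * (q - 1) > 1" and C: "C1 > 0" "C2 > 0"
  shows "g x = 0"
proof -
  have meas: "g \<in> borel_measurable borel"
    using cont by (simp add: borel_measurable_continuous_onI)
  obtain D0 where "decays g 2 D0" using dec by blast
  then have int: "integrable lborel g" using decays_integrable[OF meas] by simp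
  obtain B where "decays g 0 B" using dec by blast
  moreover have "max 1 \<bar>x\<bar> powr 0 = 1" for x :: real by simp
  ultimately have B: "cmod (g x) \<le> B" for x unfolding decays_def by (metis mult_1)
  \<comment> \<open>Integrability of the transform is drawn from its own zeros: for
    \<open>(p - 1) * n \<ge> 2\<close> the gap estimate gives enough decay.\<close>
  have intF: "integrable lborel (fourier g)"
  proof -
    obtain n :: nat where n: "real n \<ge> max 1 (2 / (p - 1))" using real_arch_simple by blast
    obtain D where D: "decays g (real n + 2) D" using dec by blast
    have "decays (fourier g) ((p - 1) * n) ((2 * pi * max 1 (6 * pi * exp 1 * C1)) ^ n * D)"
      using n by (intro decays_fourier[OF gapsF p C(1) meas D]) auto
    then show ?thesis
      by (rule decays_integrable[OF borel_measurable_fourier[OF meas]])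
         (use n p in \<open>simp add: field_simps\<close>)
  qed
  have inv: "fourier (fourier g) x = g (- x)" for x
    by (rule fourier_inversion[OF cont B int intF])
  \<comment> \<open>The double transform is the reflection of \<open>g\<close>, and the gap
    condition is invariant under reflection.\<close>
  have "zero_gaps (fourier (fourier g)) q C2"
    unfolding zero_gaps_def inv
  proof (intro allI impI)
    fix x :: real assume "\<bar>x\<bar> \<ge> 1"
    then obtain z where "g z = 0" "\<bar>z - (- x)\<bar> \<le> C2 * \<bar>- x\<bar> powr (1 - q)"
      using gaps unfolding zero_gaps_def by (metis abs_minus_cancel)
    then show "\<exists>z. g (- z) = 0 \<and> \<bar>z - x\<bar> \<le> C2 * \<bar>x\<bar> powr (1 - q)"
      by (intro exI[of _ "- z"]) (auto simp: abs_minus_commute)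
  qed
  then obtain A where A: "A \<ge> 1" "\<And>x. \<bar>x\<bar> > A \<Longrightarrow> g x = 0"
    using zero_gaps_imp_compact_support[OF cont dec gapsF _ inv p q pq C] by blast
  have "fourier g \<xi> = 0" for \<xi>
    by (rule compact_support_zero_gaps[OF int _ A(2) gapsF p C(1)]) (use A(1) in auto)
  then have "fourier g = (\<lambda>\<xi>. 0)" by auto
  then have "fourier (fourier g) (- x) = 0" by (simp add: fourier_def)
  then show ?thesis by (simp add: inv)
qed

section \<open>Schwartz functions, and powers and logarithms as zero sets\<close>

lemma schwartz_continuous:
  assumes "schwartz f"
  shows "continuous_on UNIV f"
proof -
  have "nth_deriv 0 f differentiable (at x)" for x using assms unfolding schwartz_def by blast
  then show ?thesis
    by (auto simp: nth_deriv_def continuous_on_eq_continuous_at differentiable_imp_continuous_within)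
qed

lemma schwartz_decays:
  assumes "schwartz f"
  shows "\<exists>D. decays f m D"
proof -
  obtain j :: nat where j: "m \<le> real j" using real_arch_simple by blast
  have "\<exists>C. \<forall>x. \<bar>x\<bar> ^ i * cmod (nth_deriv 0 f x) \<le> C" for i
    using assms unfolding schwartz_def by blast
  then obtain C where C: "\<And>i x. \<bar>x\<bar> ^ i * cmod (f x) \<le> C i"
    unfolding nth_deriv_def by simp metis
  have "decays f j (C 0 + C j)"
    unfolding decays_def
  proof
    fix x :: real
    have "max 1 \<bar>x\<bar> ^ j = 1 \<or> max 1 \<bar>x\<bar> ^ j = \<bar>x\<bar> ^ j" by (auto simp: max_def)
    moreover have "0 \<le> \<bar>x\<bar> ^ j" by simp
    ultimately have "max 1 \<bar>x\<bar> ^ j \<le> 1 + \<bar>x\<bar> ^ j" by linarith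
    then have "max 1 \<bar>x\<bar> ^ j * cmod (f x) \<le> (1 + \<bar>x\<bar> ^ j) * cmod (f x)"
      by (rule mult_right_mono) simp
    also have "\<dots> \<le> C 0 + C j" using C[of x 0] C[of x j] by (simp add: distrib_right)
    finally show "max 1 \<bar>x\<bar> powr j * cmod (f x) \<le> C 0 + C j" by (simp add: powr_realpow)
  qed
  then show ?thesis using decays_mono[OF _ j] by blast
qed

lemma zero_gaps_symmetric:
  assumes "\<And>x. x \<ge> 1 \<Longrightarrow> \<exists>z. G z = 0 \<and> G (- z) = 0 \<and> \<bar>z - x\<bar> \<le> C * x powr (1 - p)"
  shows "zero_gaps G p C"
  unfolding zero_gaps_def
proof (intro allI impI)
  fix x :: real assume "\<bar>x\<bar> \<ge> 1"
  then obtain z where z: "G z = 0" "G (- z) = 0" "\<bar>z - \<bar>x\<bar>\<bar> \<le> C * \<bar>x\<bar> powr (1 - p)"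
    using assms by blast
  show "\<exists>z. G z = 0 \<and> \<bar>z - x\<bar> \<le> C * \<bar>x\<bar> powr (1 - p)"
  proof (cases "x \<ge> 0")
    case True
    then show ?thesis using z by (intro exI[of _ z]) auto
  next
    case False
    then show ?thesis using z by (intro exI[of _ "- z"]) auto
  qed
qed

text \<open>Write x = y^\<alpha> and take the zero n^\<alpha> with n the floor of y. Concavity of
  the power bounds the distance by n^(\<alpha>-1), and n \<ge> y/2 turns this into the stated
  multiple of y^(\<alpha>-1) = x^(1-1/\<alpha>).\<close>

lemma zero_gaps_powers:
  assumes \<alpha>: "0 < \<alpha>" "\<alpha> < 1"
    and zeros: "\<And>n::nat. G (real n powr \<alpha>) = 0 \<and> G (- (real n powr \<alpha>)) = 0"
  shows "zero_gaps G (1 / \<alpha>) (2 powr (1 - \<alpha>))"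
proof (rule zero_gaps_symmetric)
  fix x :: real assume x: "x \<ge> 1"
  define y where "y = x powr (1 / \<alpha>)"
  have y: "y \<ge> 1" unfolding y_def using x \<alpha> by (intro ge_one_powr_ge_zero) auto
  have x_eq: "x = y powr \<alpha>" using x \<alpha> by (simp add: y_def powr_powr)
  define n where "n = nat \<lfloor>y\<rfloor>"
  have n: "n \<ge> 1" "real n \<le> y" "y < real n + 1" using y unfolding n_def by linarith+
  have n_pos: "real n > 0" using n(1) by simp
  have "real n powr \<alpha> \<le> x" unfolding x_eq using n \<alpha> by (intro powr_mono2) auto
  moreover have "x - real n powr \<alpha> \<le> 2 powr (1 - \<alpha>) * x powr (1 - 1 / \<alpha>)"
  proof -
    \<comment> \<open>This is where concavity enters: \<open>y / n \<ge> 1\<close>, so lowering the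
      exponent from 1 to \<open>\<alpha>\<close> decreases the power.\<close>
    have "(y / n) powr \<alpha> \<le> (y / n) powr 1"
      using n n_pos \<alpha> by (intro powr_mono) (auto simp: field_simps)
    then have "real n powr \<alpha> * (y / n) powr \<alpha> \<le> real n powr \<alpha> * (y / n)"
      using y n_pos by (intro mult_left_mono) auto
    also have "real n powr \<alpha> * (y / n) powr \<alpha> = x"
      using y n_pos by (simp add: x_eq flip: powr_mult)
    also have n_powr: "real n powr \<alpha> = real n powr (\<alpha> - 1) * n"
      using n_pos by (simp add: powr_diff)
    also have "real n powr (\<alpha> - 1) * n * (y / n) = real n powr (\<alpha> - 1) * y"
      using n_pos by simp
    finally have "x \<le> real n powr (\<alpha> - 1) * y" .
    then have "x - real n powr \<alpha> \<le> real n powr (\<alpha> - 1) * (y - n)"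
      using n_powr by (simp add: right_diff_distrib)
    also have "\<dots> \<le> real n powr (\<alpha> - 1) * 1"
      using n by (intro mult_left_mono) auto
    also have "\<dots> \<le> (y / 2) powr (\<alpha> - 1)"
    proof -
      have "y / 2 \<le> real n" using n(1,3) by linarith
      then show ?thesis unfolding mult_1_right using y \<alpha> by (intro powr_mono2') auto
    qed
    also have "\<dots> = 2 powr (1 - \<alpha>) * y powr (\<alpha> - 1)"
    proof -
      have "2 powr (1 - \<alpha>) = 1 / 2 powr (\<alpha> - 1)"
        using powr_minus_divide[of 2 "\<alpha> - 1"] by (simp only: minus_diff_eq)
      then show ?thesis using y by (simp only: powr_divide) simp
    qed
    also have "y powr (\<alpha> - 1) = x powr (1 - 1 / \<alpha>)"
      using \<alpha> by (simp add: y_def powr_powr diff_divide_distrib)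
    finally show ?thesis .
  qed
  ultimately show "\<exists>z. G z = 0 \<and> G (- z) = 0 \<and> \<bar>z - x\<bar> \<le> 2 powr (1 - \<alpha>) * x powr (1 - 1 / \<alpha>)"
    using zeros[of n] by (intro exI[of _ "real n powr \<alpha>"]) auto
qed

text \<open>Near \<open>x\<close> the logarithms of integers have spacing of order exp(-x), which is
  below every power of \<open>x\<close>. Hence \<open>p\<close> is arbitrary and only the constant
  depends on it.\<close>

lemma zero_gaps_logarithms:
  assumes zeros: "\<And>n::nat. G (ln (real n + 1)) = 0 \<and> G (- ln (real n + 1)) = 0"
  shows "\<exists>C>0. zero_gaps G p C"
proof -
  obtain k :: nat where k: "p - 1 \<le> real k" using real_arch_simple by blast
  have "zero_gaps G p (2 * fact k)"
  proof (rule zero_gaps_symmetric)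
    fix x :: real assume x: "x \<ge> 1"
    have "exp x \<ge> 1" using x by simp
    \<comment> \<open>The shift by one makes \<open>n + 1\<close>, the argument of the logarithm,
      the floor of \<open>exp x\<close>.\<close>
    define n where "n = nat (\<lfloor>exp x\<rfloor> - 1)"
    have n: "real n + 1 \<le> exp x" "exp x < real n + 2"
      using \<open>exp x \<ge> 1\<close> unfolding n_def by linarith+
    have le: "ln (real n + 1) \<le> x"
      using n(1) by (metis add_nonneg_pos ln_exp ln_mono of_nat_0_le_iff zero_less_one exp_gt_zero)
    have "x - ln (real n + 1) = ln (exp x / (real n + 1))"
      by (subst ln_div) auto
    also have "\<dots> \<le> exp x / (real n + 1) - 1"
      by (intro ln_le_minus_one) auto
    also have "\<dots> = (exp x - (real n + 1)) / (real n + 1)"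
      by (simp add: diff_divide_distrib)
    also have "\<dots> \<le> 1 / (real n + 1)"
      using n by (intro divide_right_mono) auto
    also have "\<dots> \<le> 2 / exp x"
      using n by (simp add: divide_simps)
    also have "\<dots> = 2 * exp (- x)" by (simp add: exp_minus divide_inverse)
    also have "\<dots> \<le> 2 * (fact k * x powr (1 - p))"
    proof -
      have "x powr (p - 1) \<le> x ^ k"
        using x powr_mono[OF k x] by (simp add: powr_realpow)
      also have "\<dots> \<le> fact k * exp x" using x by (intro power_le_fact_exp) auto
      finally have "exp (- x) * x powr (p - 1) \<le> exp (- x) * (fact k * exp x)"
        by (intro mult_left_mono) auto
      also have "\<dots> = fact k" by (simp add: exp_minus)
      finally have "exp (- x) \<le> fact k / x powr (p - 1)"
        using x by (simp add: pos_le_divide_eq)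
      also have "\<dots> = fact k * x powr (1 - p)"
        using powr_minus_divide[of x "p - 1"] by simp
      finally show ?thesis by simp
    qed
    finally show "\<exists>z. G z = 0 \<and> G (- z) = 0 \<and> \<bar>z - x\<bar> \<le> 2 * fact k * x powr (1 - p)"
      using zeros[of n] le by (intro exI[of _ "ln (real n + 1)"]) auto
  qed
  then show ?thesis by (intro exI[of _ "2 * fact k"]) auto
qed

text \<open>After clearing denominators the claim is \<alpha>\<beta> < (1-\<alpha>)(1-\<beta>), that
  is, \<alpha> + \<beta> < 1. This is the condition (p-1)(q-1) > 1 for p = 1/\<alpha> and q =
  1/\<beta>.\<close>

lemma exponent_condition:
  fixes \<alpha> \<beta> :: real
  assumes "0 < \<alpha>" "0 < \<beta>" "\<alpha> + \<beta> < 1"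
  shows "(1 / \<alpha> - 1) * (1 / \<beta> - 1) > 1"
proof -
  have "\<alpha> * \<beta> < (1 - \<alpha>) * (1 - \<beta>)" using assms by (simp add: algebra_simps)
  then have "1 < ((1 - \<alpha>) * (1 - \<beta>)) / (\<alpha> * \<beta>)" using assms by simp
  also have "\<dots> = (1 / \<alpha> - 1) * (1 / \<beta> - 1)" using assms by (simp add: field_simps)
  finally show ?thesis .
qed

theorem theorem1:
  fixes \<alpha> \<beta> :: real and f :: "real \<Rightarrow> complex"
  assumes "0 < \<alpha>" and "\<alpha> < 1" and "0 < \<beta>" and "\<beta> < 1"
    and "schwartz f"
  shows "((\<forall>n::nat. f (ln (real n + 1)) = 0 \<and> f (- ln (real n + 1)) = 0) \<and>
          (\<forall>n::nat. fourier f (real n powr \<alpha>) = 0 \<and> fourier f (- (real n powr \<alpha>)) = 0)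
            \<longrightarrow> (\<forall>x. f x = 0)) \<and>
         ((\<alpha>, \<beta>) \<in> exponent_region \<and>
          (\<forall>n::nat. f (real n powr \<alpha>) = 0 \<and> f (- (real n powr \<alpha>)) = 0) \<and>
          (\<forall>n::nat. fourier f (real n powr \<beta>) = 0 \<and> fourier f (- (real n powr \<beta>)) = 0)
            \<longrightarrow> (\<forall>x. f x = 0))"
proof (intro conjI impI allI; elim conjE)
  note uniqueness = fourier_uniqueness_zero_gaps[OF schwartz_continuous[OF \<open>schwartz f\<close>]
      schwartz_decays[OF \<open>schwartz f\<close>]]
  {
    fix x
    assume f: "\<forall>n::nat. f (ln (real n + 1)) = 0 \<and> f (- ln (real n + 1)) = 0"
      and F: "\<forall>n::nat. fourier f (real n powr \<alpha>) = 0 \<and> fourier f (- (real n powr \<alpha>)) = 0"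
    \<comment> \<open>The logarithmic zeros satisfy the gap condition for every exponent, so a
      \<open>\<gamma>\<close> with \<open>\<alpha> + \<gamma> < 1\<close> can be chosen to play the
      part of the second power.\<close>
    define \<gamma> where "\<gamma> = (1 - \<alpha>) / 2"
    have \<gamma>: "0 < \<gamma>" "\<gamma> < 1" "\<alpha> + \<gamma> < 1" using assms by (auto simp: \<gamma>_def field_simps)
    have gapsF: "zero_gaps (fourier f) (1 / \<alpha>) (2 powr (1 - \<alpha>))"
      by (rule zero_gaps_powers) (use assms F in auto)
    obtain C where "C > 0" "zero_gaps f (1 / \<gamma>) C"
      using zero_gaps_logarithms[of f] f by blast
    then show "f x = 0"
      using uniqueness[OF gapsF] exponent_condition[OF \<open>0 < \<alpha>\<close> \<gamma>(1,3)] assms \<gamma> by simp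
  }
  {
    fix x
    assume "(\<alpha>, \<beta>) \<in> exponent_region"
      and f: "\<forall>n::nat. f (real n powr \<alpha>) = 0 \<and> f (- (real n powr \<alpha>)) = 0"
      and F: "\<forall>n::nat. fourier f (real n powr \<beta>) = 0 \<and> fourier f (- (real n powr \<beta>)) = 0"
    \<comment> \<open>The summands are in this order because the uniqueness theorem takes the
      exponent of the transform first.\<close>
    then have "\<beta> + \<alpha> < 1" by (simp add: exponent_region_def)
    have "zero_gaps (fourier f) (1 / \<beta>) (2 powr (1 - \<beta>))"
      by (rule zero_gaps_powers) (use assms F in auto)
    moreover have "zero_gaps f (1 / \<alpha>) (2 powr (1 - \<alpha>))"
      by (rule zero_gaps_powers) (use assms f in auto)
    ultimately show "f x = 0"
      using uniqueness exponent_condition[OF \<open>0 < \<beta>\<close> \<open>0 < \<alpha>\<close> \<open>\<beta> + \<alpha> < 1\<close>] assms by simp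
  }
qed

end
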